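(* Let $1\le p<\infty$, let $\mu$ be a positive Borel measure on $\mathbb{D}$ satisfying the standing axiom on $D^p_\mu$ stated in the context, and let $\varphi$ be an analytic self-map of $\mathbb{D}$. The following statements are equivalent: (a) $C_\varphi$ maps $\mathcal{B}$ into $D^p_\mu$, i.e. $f\circ\varphi\in D^p_\mu$ for every $f\in\mathcal{B}$; (b) $C_\varphi$ is a bounded operator from $\mathcal{B}$ into $D^p_\mu$; (c) $\int_{\mathbb{D}}|\varphi^{\#}|^p\,d\mu<\infty$.
   Context: $\mathbb{D}=\{z\in\mathbb{C}:|z|<1\}$; $\mathcal{H}(\mathbb{D})$ is the set of analytic functions on $\mathbb{D}$. A self-map of $\mathbb{D}$ is an analytic function $\varphi:\mathbb{D}\to\mathbb{D}$, and $C_\varphi(f)=f\circ\varphi$ for $f\in\mathcal{H}(\mathbb{D})$. For a self-map $\varphi$, the hyperbolic derivative is $\varphi^{\#}(z)=\frac{|\varphi'(z)|}{1-|\varphi(z)|^2}$. The Bloch space $\mathcal{B}$ is the Banach space of all $f\in\mathcal{H}(\mathbb{D})$ with $\|f\|_{\mathcal{B}}=|f(0)|+\sup_{z\in\mathbb{D}}(1-|z|^2)|f'(z)|<\infty$. For a positive Borel measure $\mu$ on $\mathbb{D}$ and $1\le p<\infty$, $D^p_\mu$ is the space of all $f\in\mathcal{H}(\mathbb{D})$ with $\|f\|_{D^p_\mu}^p=|f(0)|^p+\int_{\mathbb{D}}|f'|^p\,d\mu<\infty$. Standing axiom: $D^p_\mu$ is a Banach space and the point-evaluation functionals $f\mapsto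 f(\zeta)$ are uniformly bounded on $D^p_\mu$ for $\zeta$ in compact subsets of $\mathbb{D}$ (for each compact $K\subset\mathbb{D}$ there is $C_K$ with $|f(\zeta)|\le C_K\|f\|_{D^p_\mu}$ for all $\zeta\in K$, $f\in D^p_\mu$). *)

theory Defs
  imports "HOL-Complex_Analysis.Complex_Analysis"
begin

abbreviation unit_disc :: "complex set"
  where "unit_disc \<equiv> ball 0 1"

text \<open>
  A function on the disc is represented by the total function that extends it by zero, so that
  equality of elements of the spaces below is equality of HOL functions.
\<close>
definition Hol_disc :: "(complex \<Rightarrow> complex) set"
  where "Hol_disc = {f. f holomorphic_on unit_disc \<and> (\<forall>z. z \<notin> unit_disc \<longrightarrow> f z = 0)}"

definition self_map_disc :: "(complex \<Rightarrow> complex) \<Rightarrow> bool"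
  where "self_map_disc \<phi> \<longleftrightarrow> \<phi> holomorphic_on unit_disc \<and> \<phi> ` unit_disc \<subseteq> unit_disc"

definition comp_op :: "(complex \<Rightarrow> complex) \<Rightarrow> (complex \<Rightarrow> complex) \<Rightarrow> complex \<Rightarrow> complex"
  where "comp_op \<phi> f = (\<lambda>z. if z \<in> unit_disc then f (\<phi> z) else 0)"

definition hyperbolic_deriv :: "(complex \<Rightarrow> complex) \<Rightarrow> complex \<Rightarrow> real"
  where "hyperbolic_deriv \<phi> z = cmod (deriv \<phi> z) / (1 - (cmod (\<phi> z))\<^sup>2)"

definition Bloch :: "(complex \<Rightarrow> complex) set"
  where "Bloch = {f \<in> Hol_disc.
    bdd_above ((\<lambda>z. (1 - (cmod z)\<^sup>2) * cmod (deriv f z)) ` unit_disc)}"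

definition Bloch_norm :: "(complex \<Rightarrow> complex) \<Rightarrow> real"
  where "Bloch_norm f =
    cmod (f 0) + (SUP z\<in>unit_disc. (1 - (cmod z)\<^sup>2) * cmod (deriv f z))"

text \<open>Borel measures on the disc itself; no finiteness is required.\<close>
definition borel_measure_disc :: "complex measure \<Rightarrow> bool"
  where "borel_measure_disc \<mu> \<longleftrightarrow> sets \<mu> = sets (restrict_space borel unit_disc)"

definition D_space :: "real \<Rightarrow> complex measure \<Rightarrow> (complex \<Rightarrow> complex) set"
  where "D_space p \<mu> = {f \<in> Hol_disc. (\<integral>\<^sup>+ z. ennreal (cmod (deriv f z) powr p) \<partial>\<mu>) < \<infinity>}"

text \<open>Only meaningful for members of \<^const>\<open>D_space\<close>: \<^const>\<open>enn2real\<close> sends infinity to zero.\<close>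
definition D_norm :: "real \<Rightarrow> complex measure \<Rightarrow> (complex \<Rightarrow> complex) \<Rightarrow> real"
  where "D_norm p \<mu> f =
    (cmod (f 0) powr p + enn2real (\<integral>\<^sup>+ z. ennreal (cmod (deriv f z) powr p) \<partial>\<mu>)) powr (1 / p)"

definition normed_function_space ::
    "(complex \<Rightarrow> complex) set \<Rightarrow> ((complex \<Rightarrow> complex) \<Rightarrow> real) \<Rightarrow> bool"
  where "normed_function_space X N \<longleftrightarrow>
    (\<lambda>z. 0) \<in> X \<and>
    (\<forall>f\<in>X. \<forall>g\<in>X. (\<lambda>z. f z + g z) \<in> X \<and> N (\<lambda>z. f z + g z) \<le> N f + N g) \<and>
    (\<forall>c. \<forall>f\<in>X. (\<lambda>z. c * f z) \<in> X \<and> N (\<lambda>z. c * f z) = cmod c * N f) \<and>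
    (\<forall>f\<in>X. 0 \<le> N f \<and> (N f = 0 \<longleftrightarrow> f = (\<lambda>z. 0)))"

definition banach_function_space ::
    "(complex \<Rightarrow> complex) set \<Rightarrow> ((complex \<Rightarrow> complex) \<Rightarrow> real) \<Rightarrow> bool"
  where "banach_function_space X N \<longleftrightarrow>
    normed_function_space X N \<and>
    (\<forall>\<sigma> :: nat \<Rightarrow> complex \<Rightarrow> complex.
      (\<forall>n. \<sigma> n \<in> X) \<and>
      (\<forall>\<epsilon>>0. \<exists>M. \<forall>m\<ge>M. \<forall>n\<ge>M. N (\<lambda>z. \<sigma> m z - \<sigma> n z) < \<epsilon>) \<longrightarrow>
      (\<exists>f\<in>X. (\<lambda>n. N (\<lambda>z. \<sigma> n z - f z)) \<longlonglongrightarrow> 0))"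

definition evaluations_locally_bounded ::
    "(complex \<Rightarrow> complex) set \<Rightarrow> ((complex \<Rightarrow> complex) \<Rightarrow> real) \<Rightarrow> bool"
  where "evaluations_locally_bounded X N \<longleftrightarrow>
    (\<forall>K. compact K \<and> K \<subseteq> unit_disc \<longrightarrow>
      (\<exists>C. \<forall>\<zeta>\<in>K. \<forall>f\<in>X. cmod (f \<zeta>) \<le> C * N f))"

definition bounded_operator ::
    "(complex \<Rightarrow> complex) set \<Rightarrow> ((complex \<Rightarrow> complex) \<Rightarrow> real) \<Rightarrow>
     (complex \<Rightarrow> complex) set \<Rightarrow> ((complex \<Rightarrow> complex) \<Rightarrow> real) \<Rightarrow>
     ((complex \<Rightarrow> complex) \<Rightarrow> complex \<Rightarrow> complex) \<Rightarrow> bool"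
  where "bounded_operator X N Y M T \<longleftrightarrow>
    T ` X \<subseteq> Y \<and>
    (\<forall>f\<in>X. \<forall>g\<in>X. T (\<lambda>z. f z + g z) = (\<lambda>z. T f z + T g z)) \<and>
    (\<forall>c. \<forall>f\<in>X. T (\<lambda>z. c * f z) = (\<lambda>z. c * T f z)) \<and>
    (\<exists>C. \<forall>f\<in>X. M (T f) \<le> C * N f)"

end

theory Submission
  imports Defs
begin

text \<open>
  Since \<open>|(f \<circ> \<phi>)'| \<le> \<parallel>f\<parallel> \<phi>\<^sup>#\<close> for every Bloch function \<open>f\<close>, (c) implies (b).
  For (a) implies (c) there are finitely many Bloch functions such that at every point \<open>w\<close> of the
  disc one of them satisfies \<open>|f'(w)| \<ge> c / (1 - |w|\<^sup>2)\<close>; hence \<open>\<phi>\<^sup>#\<close> is dominated by the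
  sum of the moduli of the derivatives of their compositions with \<open>\<phi>\<close>. Besides the identity,
  which serves \<open>|w| < 1/2\<close>, they are the lacunary series
  \<open>\<Sum>k. w ^ (2\<^sup>i * 16\<^sup>k)\<close> with \<open>i < 4\<close>. If \<open>1 - 1/N \<le> |w| \<le> 1 - 1/(2N)\<close> for an exponent \<open>N\<close>,
  then the term with exponent \<open>N\<close> dominates all others in the derivative, and because
  the exponents of the four series together are all powers of 2, these annuli exhaust
  \<open>1/2 \<le> |w| < 1\<close>.
\<close>

section \<open>Upper bounds for sums over lacunary exponents\<close>

lemma card_times_power_le_sum:
  fixes r :: real
  assumes "0 \<le> r" "r \<le> 1" "m \<le> M"
  shows "real (M - m) * r ^ (M - 1) \<le> (\<Sum>j=m..<M. r ^ j)"
proof -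
  have "real (card {m..<M}) * r ^ (M - 1) \<le> (\<Sum>j=m..<M. r ^ j)"
    by (rule sum_bounded_below) (use assms in \<open>auto intro!: power_decreasing\<close>)
  then show ?thesis by simp
qed

text \<open>The exponents \<open>N n, ..., N (Suc n) - 1\<close> form disjoint blocks. Since
  \<open>N\<close> at least doubles, each block contains at least half of \<open>N (Suc n)\<close>
  indices, and every power in it is at least \<open>r ^ (N (Suc n) - 1)\<close>; so twice the block
  sum pays for one lacunary term.\<close>

lemma lacunary_sum_le_geometric_sum:
  fixes r :: real and N :: "nat \<Rightarrow> nat"
  assumes r: "0 \<le> r" "r \<le> 1" and N: "\<And>k. 2 * N k \<le> N (Suc k)"
  shows "(\<Sum>k\<le>n. real (N k) * r ^ (N k - 1)) \<le> 2 * (\<Sum>j<N n. r ^ j)"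
proof (induction n)
  case 0
  have "real (N 0) * r ^ (N 0 - 1) \<le> (\<Sum>j<N 0. r ^ j)"
    using card_times_power_le_sum[OF r, of 0 "N 0"] by (simp add: lessThan_atLeast0)
  moreover have "0 \<le> (\<Sum>j<N 0. r ^ j)"
    using r by (intro sum_nonneg) auto
  ultimately show ?case by simp
next
  case (Suc n)
  have le: "N n \<le> N (Suc n)" using N[of n] by simp
  have "real (N (Suc n)) * r ^ (N (Suc n) - 1)
      \<le> 2 * (real (N (Suc n) - N n) * r ^ (N (Suc n) - 1))"
  proof -
    have "real (N (Suc n)) \<le> 2 * real (N (Suc n) - N n)" using N[of n] by linarith
    then show ?thesis
      using mult_right_mono[of _ _ "r ^ (N (Suc n) - 1)"] r by (simp flip: mult.assoc)
  qed
  also have "\<dots> \<le> 2 * (\<Sum>j=N n..<N (Suc n). r ^ j)"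
    using card_times_power_le_sum[OF r le] by simp
  finally have "(\<Sum>k\<le>Suc n. real (N k) * r ^ (N k - 1))
      \<le> 2 * ((\<Sum>j<N n. r ^ j) + (\<Sum>j=N n..<N (Suc n). r ^ j))"
    using Suc.IH by simp
  also have "(\<Sum>j<N n. r ^ j) + (\<Sum>j=N n..<N (Suc n). r ^ j) = (\<Sum>j<N (Suc n). r ^ j)"
    using le by (simp add: lessThan_atLeast0 sum.atLeastLessThan_concat)
  finally show ?case .
qed

text \<open>The bound is independent of \<open>n\<close> and grows only like
  \<open>1 / (1 - r)\<close>, which is exactly the growth allowed for the derivative of a Bloch
  function.\<close>

lemma lacunary_sum_le:
  fixes r :: real and N :: "nat \<Rightarrow> nat"
  assumes r: "0 \<le> r" "r < 1" and N: "\<And>k. 2 * N k \<le> N (Suc k)"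
  shows "(\<Sum>k<n. real (N k) * r ^ (N k - 1)) \<le> 2 / (1 - r)"
proof (cases n)
  case (Suc m)
  have "(\<Sum>k<n. real (N k) * r ^ (N k - 1)) \<le> 2 * (\<Sum>j<N m. r ^ j)"
    using lacunary_sum_le_geometric_sum[of r N m] r N
    by (simp add: Suc lessThan_Suc_atMost)
  also have "\<dots> \<le> 2 / (1 - r)"
    using r by (simp add: sum_gp_strict divide_simps)
  finally show ?thesis .
qed (use r in auto)

section \<open>Lacunary power series and dyadic annuli\<close>

lemma lacunary_series_has_derivative:
  fixes N :: "nat \<Rightarrow> nat"
  assumes N: "strict_mono N"
  obtains g g' where
    "\<And>z. z \<in> unit_disc \<Longrightarrow> (\<lambda>k. of_nat (N k) * z ^ (N k - 1)) sums g' z"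
    "\<And>z. z \<in> unit_disc \<Longrightarrow> (g has_field_derivative g' z) (at z)"
proof -
  have "\<exists>g g'. \<forall>z\<in>unit_disc. ((\<lambda>k. z ^ N k) sums g z)
      \<and> ((\<lambda>k. of_nat (N k) * z ^ (N k - 1)) sums g' z)
      \<and> (g has_field_derivative g' z) (at z)"
  proof (rule series_and_derivative_comparison_complex)
    fix z :: complex
    assume z: "z \<in> unit_disc"
    \<comment> \<open>The midpoint between \<open>cmod z\<close> and 1: the ball of radius
      \<open>s - cmod z\<close> about \<open>z\<close> stays inside
      \<open>cmod y \<le> s < 1\<close>, and \<open>k \<le> N k\<close> then gives the geometric
      majorant \<open>s ^ k\<close>.\<close>
    define s where "s = (1 + cmod z) / 2"
    have s: "0 \<le> s" "s < 1" using z by (auto simp: s_def)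
    have le: "cmod (y ^ N k) \<le> cmod (complex_of_real s ^ k)" if "y \<in> ball z (s - cmod z)" for y k
    proof -
      have "cmod y \<le> s"
        using that norm_triangle_ineq2[of y z] by (auto simp: dist_norm norm_minus_commute)
      then have "cmod y ^ N k \<le> s ^ N k" by (intro power_mono) auto
      also have "\<dots> \<le> s ^ k"
        using s strict_mono_imp_increasing[OF N, of k] by (intro power_decreasing) auto
      finally show ?thesis using s by (simp add: norm_power)
    qed
    show "\<exists>d h. 0 < d \<and> summable h \<and> range h \<subseteq> \<real>\<^sub>\<ge>\<^sub>0 \<and>
        (\<forall>\<^sub>F k in sequentially. \<forall>y\<in>ball z d \<inter> unit_disc. cmod (y ^ N k) \<le> cmod (h k))"
    proof (intro exI conjI)
      show "0 < s - cmod z" using z by (auto simp: s_def field_simps)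
      show "summable (\<lambda>k. complex_of_real s ^ k)"
        using s by (intro summable_geometric) auto
      show "range (\<lambda>k. complex_of_real s ^ k) \<subseteq> \<real>\<^sub>\<ge>\<^sub>0"
        using s by (auto simp flip: of_real_power)
    qed (use le in auto)
  qed (auto intro!: derivative_eq_intros)
  then show ?thesis using that by blast
qed

text \<open>After multiplication by \<open>z\<close> the terms have modulus \<open>t k\<close>. The
  term \<open>K\<close> is at least \<open>N K / 4\<close>, the earlier ones add up to at most
  \<open>N K / 15\<close>, and the later ones, shrinking by a factor 8 each, to at most
  \<open>t K / 7\<close>. What remains is at least \<open>(6/7) * (1/4) - 1/15 > 1/8\<close> of
  \<open>N K\<close>.\<close>

lemma lacunary_derivative_lower_bound:
  fixes a K :: nat and z d :: complex
  defines "N \<equiv> (\<lambda>k. a * 16 ^ k)"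
  assumes a: "a > 0" and even: "even (N K)"
    and lo: "1 - 1 / real (N K) \<le> cmod z" and hi: "cmod z \<le> 1 - 1 / (2 * real (N K))"
    and d: "(\<lambda>k. of_nat (N k) * z ^ (N k - 1)) sums d"
  shows "real (N K) \<le> 8 * cmod d"
proof -
  define r where "r = cmod z"
  define t where "t k = real (N k) * r ^ N k" for k
  have pos: "N k > 0" for k using a by (simp add: N_def)
  have "1 / (2 * real (N K)) > 0" using pos by simp
  then have r: "0 \<le> r" "r < 1" using hi unfolding r_def by (simp, linarith)
  have t_nonneg: "0 \<le> t k" for k using r by (simp add: t_def)
  \<comment> \<open>With \<open>r \<le> 1 - h\<close> one has \<open>r * (1 + h) \<le> 1\<close>,
    while Bernoulli gives \<open>(1 + h) ^ (2 * N K) \<ge> 2\<close>.\<close>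
  have r_pow: "r ^ (2 * N K) \<le> 1 / 2"
  proof -
    define h where "h = 1 / (2 * real (N K))"
    have h: "0 < h" "h \<le> 1" using pos[of K] by (auto simp: h_def)
    have "2 = 1 + real (2 * N K) * h" using pos[of K] by (simp add: h_def)
    also have "\<dots> \<le> (1 + h) ^ (2 * N K)" using h by (intro Bernoulli_inequality) simp
    finally have "r ^ (2 * N K) * 2 \<le> r ^ (2 * N K) * (1 + h) ^ (2 * N K)"
      using r by (intro mult_left_mono) auto
    also have "\<dots> = (r * (1 + h)) ^ (2 * N K)" by (simp add: power_mult_distrib)
    also have "\<dots> \<le> 1 ^ (2 * N K)"
    proof (rule power_mono)
      have "r * (1 + h) \<le> (1 - h) * (1 + h)"
        using hi h unfolding r_def h_def by (intro mult_right_mono) auto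
      also have "\<dots> \<le> 1" by (simp add: algebra_simps)
      finally show "r * (1 + h) \<le> 1" .
    qed (use r h in auto)
    finally show ?thesis by simp
  qed
  \<comment> \<open>The next term gains a factor 16 from its coefficient and
    \<open>r ^ (15 * N k)\<close> from its power. As \<open>15 * N k\<close> exceeds
    \<open>7 * (2 * N K)\<close>, the power is at most \<open>2 ^ (-7)\<close>, a net factor of
    1/8.\<close>
  have t_Suc: "8 * t (Suc k) \<le> t k" if "K \<le> k" for k
  proof -
    have "(16::nat) ^ K \<le> 16 ^ k" using that by (intro power_increasing) auto
    then have "N K \<le> N k" by (simp add: N_def)
    then have "r ^ (15 * N k) \<le> r ^ (2 * N K * 7)" using r by (intro power_decreasing) auto
    also have "\<dots> = (r ^ (2 * N K)) ^ 7" by (rule power_mult)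
    also have "\<dots> \<le> (1 / 2) ^ 7" using r_pow r by (intro power_mono) auto
    finally have "r ^ (15 * N k) \<le> 1 / 128" by (simp add: power_divide)
    then have "128 * (t k * r ^ (15 * N k)) \<le> t k"
      using mult_left_mono[of "r ^ (15 * N k)" "1 / 128" "t k"] t_nonneg[of k] by simp
    moreover have "t (Suc k) = 16 * (t k * r ^ (15 * N k))"
      by (simp add: t_def N_def mult.left_commute flip: power_add)
    ultimately show ?thesis by simp
  qed
  \<comment> \<open>The summand \<open>t (K + m)\<close> carries the induction: the new
    \<open>7 * t (Suc K + m)\<close> and \<open>t (Suc K + m)\<close> combine to 8 times that term,
    which \<open>t (K + m)\<close> absorbs.\<close>
  have upper: "7 * (\<Sum>i<m. t (Suc K + i)) + t (K + m) \<le> t K" for m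
  proof (induction m)
    case (Suc m)
    then show ?case using t_Suc[of "K + m"] by simp
  qed simp
  have lower: "15 * (\<Sum>k<n. N k) \<le> N n" for n
    by (induction n) (auto simp: N_def)
  have lower': "15 * (\<Sum>k<K. t k) \<le> real (N K)"
  proof -
    have "(\<Sum>k<K. t k) \<le> (\<Sum>k<K. real (N k))"
      using r by (intro sum_mono) (simp add: t_def mult_left_le power_le_one)
    moreover have "real (15 * (\<Sum>k<K. N k)) \<le> real (N K)"
      using lower[of K] by (simp only: of_nat_le_iff)
    ultimately show ?thesis by simp
  qed
  have main: "real (N K) \<le> 4 * t K"
  proof -
    \<comment> \<open>Bernoulli applied to \<open>(1 - 1 / N K) ^ N K\<close> itself would only give
      0. With half the exponent it gives 1/2, and squaring yields 1/4.\<close>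
    obtain M where M: "N K = 2 * M" using even by blast
    have "M > 0" using M pos[of K] by simp
    have "1 / 2 = 1 + real M * (- 1 / real (N K))" using \<open>M > 0\<close> by (simp add: M)
    also have "\<dots> \<le> (1 + (- 1 / real (N K))) ^ M"
      using pos[of K] by (intro Bernoulli_inequality) (auto simp: divide_simps)
    also have "\<dots> \<le> r ^ M"
      using lo pos[of K] unfolding r_def by (intro power_mono) (auto simp: divide_simps)
    finally have "(1 / 2) ^ 2 \<le> (r ^ M) ^ 2" by (intro power_mono) auto
    then have "1 / 4 \<le> r ^ N K" by (simp add: M power_divide mult.commute flip: power_mult)
    then show ?thesis
      using mult_left_mono[of "1 / 4" "r ^ N K" "real (N K)"] by (simp add: t_def)
  qed
  \<comment> \<open>The factor \<open>z\<close> turns the exponents \<open>N k - 1\<close> into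
    \<open>N k\<close>; it costs nothing in the end because \<open>cmod z \<le> 1\<close>.\<close>
  define c where "c k = of_nat (N k) * z ^ N k" for k
  have norm_c: "cmod (c k) = t k" for k
    by (simp add: c_def t_def r_def norm_mult norm_power)
  have "c = (\<lambda>k. z * (of_nat (N k) * z ^ (N k - 1)))"
    using pos by (auto simp: c_def fun_eq_iff power_eq_if)
  then have "c sums (z * d)" using sums_mult[OF d, of z] by simp
  then have lim: "(\<lambda>m. \<Sum>k<m + Suc K. c k) \<longlonglongrightarrow> z * d"
    unfolding sums_def by (rule LIMSEQ_ignore_initial_segment)
  have "real (N K) / 8 \<le> cmod (\<Sum>k<m + Suc K. c k)" for m
  proof -
    have split: "(\<Sum>k<m + Suc K. c k) = (\<Sum>k<K. c k) + c K + (\<Sum>i<m. c (Suc K + i))"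
      by (induction m) (simp_all add: add.commute)
    have "cmod (\<Sum>k<K. c k) \<le> (\<Sum>k<K. t k)"
      using norm_sum[of c "{..<K}"] by (simp add: norm_c)
    moreover have "cmod (\<Sum>i<m. c (Suc K + i)) \<le> (\<Sum>i<m. t (Suc K + i))"
      using norm_sum[of "\<lambda>i. c (Suc K + i)" "{..<m}"] by (simp add: norm_c)
    moreover have "cmod (c K) \<le> cmod ((\<Sum>k<K. c k) + c K + (\<Sum>i<m. c (Suc K + i)))
        + cmod (\<Sum>k<K. c k) + cmod (\<Sum>i<m. c (Suc K + i))"
      by norm
    ultimately show ?thesis
      unfolding split using upper[of m] lower' main t_nonneg[of "K + m"] norm_c[of K]
      by linarith
  qed
  then have "real (N K) / 8 \<le> cmod (z * d)"
    by (intro Lim_norm_lbound[OF _ lim]) (auto intro: always_eventually)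
  also have "\<dots> \<le> cmod d"
    using r by (simp add: norm_mult r_def mult_left_le_one_le)
  finally show ?thesis by simp
qed

text \<open>The least index satisfying the upper bound also satisfies the lower one, by failure of
  the upper bound at the preceding index. The condition \<open>1 \<le> n\<close> makes the exponent
  \<open>2 ^ n\<close> even, as the lower estimate for the derivative requires.\<close>

lemma dyadic_annulus:
  fixes r :: real
  assumes "1 / 2 \<le> r" "r < 1"
  obtains n :: nat where "1 \<le> n" "1 - 1 / 2 ^ n \<le> r" "r \<le> 1 - 1 / (2 * 2 ^ n)"
proof -
  define P where "P n \<longleftrightarrow> r \<le> 1 - (1 / 2) ^ Suc n" for n
  obtain n0 where "(1 / 2 :: real) ^ n0 < 1 - r"
    using real_arch_pow_inv[of "1 - r" "1 / 2"] assms by auto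
  moreover have "(1 / 2 :: real) ^ Suc n0 \<le> (1 / 2) ^ n0" by (intro power_decreasing) auto
  ultimately have "P n0" unfolding P_def by linarith
  define n where "n = (LEAST n. P n)"
  have Pn: "P n" using LeastI[of P, OF \<open>P n0\<close>] by (simp add: n_def)
  show ?thesis
  proof (cases "n = 0")
    case True
    then have "r = 1 / 2" using Pn assms by (simp add: P_def)
    \<comment> \<open>The boundary value \<open>r = 1 / 2\<close> belongs to the annulus of index 1
      as well.\<close>
    then show ?thesis by (intro that[of 1]) auto
  next
    case False
    then have "\<not> P (n - 1)" using not_less_Least[of "n - 1" P] by (simp add: n_def)
    then show ?thesis using Pn False by (intro that[of n]) (auto simp: P_def power_divide)
  qed
qed

section \<open>Finitely many Bloch functions with jointly maximal derivative\<close>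

lemma deriv_zero_extension:
  assumes "z \<in> unit_disc"
  shows "deriv (\<lambda>z. if z \<in> unit_disc then f z else 0) z = deriv f z"
  using assms
  by (intro deriv_cong_ev refl) (auto intro: eventually_mono[OF eventually_nhds_in_open[of unit_disc]])

text \<open>Members of \<open>Bloch\<close> vanish off the disc, so a function known only through
  its derivative on the disc has to be cut off; derivatives inside the open disc do not notice
  this.\<close>

lemma zero_extension_in_Bloch:
  assumes g: "\<And>z. z \<in> unit_disc \<Longrightarrow> (g has_field_derivative g' z) (at z)"
    and B: "\<And>z. z \<in> unit_disc \<Longrightarrow> (1 - (cmod z)\<^sup>2) * cmod (g' z) \<le> B"
  shows "(\<lambda>z. if z \<in> unit_disc then g z else 0) \<in> Bloch"
    and "\<And>z. z \<in> unit_disc \<Longrightarrow> deriv (\<lambda>z. if z \<in> unit_disc then g z else 0) z = g' z"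
proof -
  show deriv: "deriv (\<lambda>z. if z \<in> unit_disc then g z else 0) z = g' z" if "z \<in> unit_disc" for z
    using deriv_zero_extension[OF that, of g] DERIV_imp_deriv[OF g[OF that]] by simp
  have "g holomorphic_on unit_disc"
    using g by (subst holomorphic_on_open) blast+
  then have "(\<lambda>z. if z \<in> unit_disc then g z else 0) holomorphic_on unit_disc"
    by (rule holomorphic_transform) auto
  moreover have "bdd_above ((\<lambda>z. (1 - (cmod z)\<^sup>2) *
      cmod (deriv (\<lambda>z. if z \<in> unit_disc then g z else 0) z)) ` unit_disc)"
    by (rule bdd_aboveI[of _ B]) (use deriv B in auto)
  ultimately show "(\<lambda>z. if z \<in> unit_disc then g z else 0) \<in> Bloch"
    by (auto simp: Bloch_def Hol_disc_def)
qed

lemma lacunary_Bloch_function: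
  fixes a :: nat
  assumes a: "a > 0"
  obtains f where "f \<in> Bloch"
    "\<And>z K. z \<in> unit_disc \<Longrightarrow> even (a * 16 ^ K) \<Longrightarrow> 1 - 1 / real (a * 16 ^ K) \<le> cmod z
      \<Longrightarrow> cmod z \<le> 1 - 1 / (2 * real (a * 16 ^ K)) \<Longrightarrow> real (a * 16 ^ K) \<le> 8 * cmod (deriv f z)"
proof -
  define N where "N k = a * 16 ^ k" for k
  have "strict_mono N"
    unfolding strict_mono_Suc_iff using a by (simp add: N_def)
  then obtain g g' where
    sums: "\<And>z. z \<in> unit_disc \<Longrightarrow> (\<lambda>k. of_nat (N k) * z ^ (N k - 1)) sums g' z" and
    g: "\<And>z. z \<in> unit_disc \<Longrightarrow> (g has_field_derivative g' z) (at z)"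
    by (rule lacunary_series_has_derivative) blast
  have B: "(1 - (cmod z)\<^sup>2) * cmod (g' z) \<le> 4" if z: "z \<in> unit_disc" for z
  proof -
    define r where "r = cmod z"
    have r: "0 \<le> r" "r < 1" using z by (auto simp: r_def)
    have "cmod (\<Sum>k<n. of_nat (N k) * z ^ (N k - 1)) \<le> 2 / (1 - r)" for n
    proof -
      have "cmod (\<Sum>k<n. of_nat (N k) * z ^ (N k - 1)) \<le> (\<Sum>k<n. real (N k) * r ^ (N k - 1))"
        by (rule order_trans[OF norm_sum]) (simp add: norm_mult norm_power r_def)
      also have "\<dots> \<le> 2 / (1 - r)"
        by (rule lacunary_sum_le[OF r]) (simp add: N_def)
      finally show ?thesis .
    qed
    then have "cmod (g' z) \<le> 2 / (1 - r)"
      by (intro Lim_norm_ubound[OF _ sums[OF z, unfolded sums_def]]) (auto intro: always_eventually)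
    \<comment> \<open>The Bloch weight factors as \<open>(1 + r) * (1 - r)\<close>, where
      \<open>1 + r \<le> 2\<close>.\<close>
    then have "(1 + r) * ((1 - r) * cmod (g' z)) \<le> 2 * 2"
      using r by (intro mult_mono) (auto simp: mult.commute pos_le_divide_eq)
    then show ?thesis by (simp add: r_def power2_eq_square algebra_simps)
  qed
  note ext = zero_extension_in_Bloch[OF g B]
  show ?thesis
  proof (rule that[OF ext(1)])
    fix z K
    assume "z \<in> unit_disc" and *: "even (a * 16 ^ K)" "1 - 1 / real (a * 16 ^ K) \<le> cmod z"
      "cmod z \<le> 1 - 1 / (2 * real (a * 16 ^ K))"
    then show "real (a * 16 ^ K) \<le> 8 * cmod (deriv (\<lambda>z. if z \<in> unit_disc then g z else 0) z)"
      using lacunary_derivative_lower_bound[OF a *, of "g' z"] sums[of z] ext(2)[of z]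
      by (simp add: N_def)
  qed
qed

lemma finite_Bloch_family_maximal_derivative:
  obtains F where "finite F" "F \<subseteq> Bloch"
    "\<And>z. z \<in> unit_disc \<Longrightarrow> \<exists>f\<in>F. 1 \<le> 16 * (1 - (cmod z)\<^sup>2) * cmod (deriv f z)"
proof -
  \<comment> \<open>Written with object-level quantifiers so that a choice function
    \<open>i \<mapsto> f i\<close> can be extracted.\<close>
  have "\<exists>f. f \<in> Bloch \<and> (\<forall>z K. z \<in> unit_disc \<longrightarrow> even (2 ^ i * 16 ^ K :: nat) \<longrightarrow>
      1 - 1 / real (2 ^ i * 16 ^ K) \<le> cmod z \<longrightarrow> cmod z \<le> 1 - 1 / (2 * real (2 ^ i * 16 ^ K)) \<longrightarrow>
      real (2 ^ i * 16 ^ K) \<le> 8 * cmod (deriv f z))" for i :: nat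
  proof -
    obtain f where "f \<in> Bloch" and "\<And>z K. z \<in> unit_disc \<Longrightarrow> even (2 ^ i * 16 ^ K :: nat) \<Longrightarrow>
      1 - 1 / real (2 ^ i * 16 ^ K) \<le> cmod z \<Longrightarrow> cmod z \<le> 1 - 1 / (2 * real (2 ^ i * 16 ^ K)) \<Longrightarrow>
      real (2 ^ i * 16 ^ K) \<le> 8 * cmod (deriv f z)"
      by (rule lacunary_Bloch_function[of "2 ^ i"]) auto
    then show ?thesis by (intro exI[of _ f] conjI allI impI)
  qed
  then obtain f where f: "\<And>i. f i \<in> Bloch" and
    fd: "\<And>i z K. z \<in> unit_disc \<Longrightarrow> even (2 ^ i * 16 ^ K :: nat) \<Longrightarrow>
      1 - 1 / real (2 ^ i * 16 ^ K) \<le> cmod z \<Longrightarrow> cmod z \<le> 1 - 1 / (2 * real (2 ^ i * 16 ^ K)) \<Longrightarrow>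
      real (2 ^ i * 16 ^ K) \<le> 8 * cmod (deriv (f i) z)"
    by metis
  have "((\<lambda>z. z) has_field_derivative 1) (at z)" for z :: complex by simp
  note ident = zero_extension_in_Bloch[of "\<lambda>z. z" "\<lambda>_. 1" 1, OF this]
  define e :: "complex \<Rightarrow> complex" where "e = (\<lambda>z. if z \<in> unit_disc then z else 0)"
  have e: "e \<in> Bloch" unfolding e_def by (rule ident) auto
  have ed: "deriv e z = 1" if "z \<in> unit_disc" for z
    unfolding e_def by (rule ident) (use that in auto)
  show ?thesis
  proof (rule that[of "insert e (f ` {..<4})"])
    fix z :: complex
    assume z: "z \<in> unit_disc"
    define r where "r = cmod z"
    have r: "0 \<le> r" "r < 1" using z by (auto simp: r_def)
    show "\<exists>f\<in>insert e (f ` {..<4}). 1 \<le> 16 * (1 - (cmod z)\<^sup>2) * cmod (deriv f z)"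
    proof (cases "r < 1 / 2")
      case True
      then have "r\<^sup>2 \<le> (1 / 2)\<^sup>2" using r by (intro power_mono) auto
      then have "1 \<le> 16 * (1 - (cmod z)\<^sup>2) * cmod (deriv e z)"
        using ed[OF z] by (simp add: r_def power2_eq_square)
      then show ?thesis by blast
    next
      case False
      then obtain n :: nat where n: "1 \<le> n" "1 - 1 / 2 ^ n \<le> r" "r \<le> 1 - 1 / (2 * 2 ^ n)"
        using dyadic_annulus[of r] r by auto
      \<comment> \<open>Since \<open>16 = 2 ^ 4\<close>, division of \<open>n\<close> by 4 selects
        the series \<open>i\<close> and the position \<open>K\<close> at which the exponent
        \<open>2 ^ n\<close> occurs.\<close>
      define i where "i = n mod 4"
      define K where "K = n div 4"
      have "(2::nat) ^ n = 2 ^ (i + 4 * K)" by (simp add: i_def K_def)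
      also have "\<dots> = 2 ^ i * 16 ^ K" by (simp add: power_add power_mult)
      finally have N: "2 ^ i * 16 ^ K = (2::nat) ^ n" by simp
      have "2 ^ n \<le> 8 * cmod (deriv (f i) z)"
        using fd[OF z, of i K] n unfolding N r_def by simp
      \<comment> \<open>The outer edge of the annulus contributes the factor 2, which with the 8 of
        the derivative bound makes the constant 16.\<close>
      moreover have "1 \<le> 2 * 2 ^ n * (1 - r)"
        using n(3) by (simp add: field_simps)
      moreover have "1 - r \<le> 1 - r\<^sup>2"
        using r by (simp add: power2_eq_square mult_left_le)
      ultimately have "1 \<le> 2 * (8 * cmod (deriv (f i) z)) * (1 - r\<^sup>2)"
        using r by (smt (verit) mult_mono norm_ge_zero zero_le_power)
      then have "1 \<le> 16 * (1 - (cmod z)\<^sup>2) * cmod (deriv (f i) z)"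
        by (simp add: r_def mult_ac)
      then show ?thesis by (auto simp: i_def)
    qed
  qed (use f e in auto)
qed

section \<open>Composition with a self-map and estimates for Bloch functions\<close>

lemma self_map_discD:
  assumes "self_map_disc \<phi>" "z \<in> unit_disc"
  shows "\<phi> z \<in> unit_disc"
  using assms unfolding self_map_disc_def by blast

lemma comp_op_in_Hol_disc:
  assumes \<phi>: "self_map_disc \<phi>" and f: "f \<in> Hol_disc"
  shows "comp_op \<phi> f \<in> Hol_disc"
proof -
  have "(f \<circ> \<phi>) holomorphic_on unit_disc"
    using \<phi> f by (intro holomorphic_on_compose_gen[of _ _ f unit_disc])
      (auto simp: self_map_disc_def Hol_disc_def)
  then have "comp_op \<phi> f holomorphic_on unit_disc"
    by (rule holomorphic_transform) (auto simp: comp_op_def)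
  then show ?thesis by (auto simp: Hol_disc_def comp_op_def)
qed

lemma deriv_comp_op:
  assumes \<phi>: "self_map_disc \<phi>" and f: "f \<in> Hol_disc" and z: "z \<in> unit_disc"
  shows "deriv (comp_op \<phi> f) z = deriv f (\<phi> z) * deriv \<phi> z"
proof -
  have "\<phi> z \<in> unit_disc" by (rule self_map_discD[OF \<phi> z])
  then have "\<phi> field_differentiable at z" "f field_differentiable at (\<phi> z)"
    using \<phi> f z unfolding self_map_disc_def Hol_disc_def
    by (auto intro: holomorphic_on_imp_differentiable_at[of _ unit_disc])
  then have "deriv (f \<circ> \<phi>) z = deriv f (\<phi> z) * deriv \<phi> z" by (rule deriv_chain)
  then show ?thesis
    using deriv_zero_extension[OF z, of "f \<circ> \<phi>"] unfolding comp_op_def o_def by (rule trans[rotated])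
qed

lemma Bloch_deriv_le:
  assumes f: "f \<in> Bloch" and z: "z \<in> unit_disc"
  shows "cmod (deriv f z) \<le> Bloch_norm f / (1 - (cmod z)\<^sup>2)"
proof -
  have "(1 - (cmod z)\<^sup>2) * cmod (deriv f z)
      \<le> (SUP z\<in>unit_disc. (1 - (cmod z)\<^sup>2) * cmod (deriv f z))"
    using f z by (intro cSUP_upper) (auto simp: Bloch_def)
  also have "\<dots> \<le> Bloch_norm f" by (simp add: Bloch_norm_def)
  finally have "(1 - (cmod z)\<^sup>2) * cmod (deriv f z) \<le> Bloch_norm f" .
  moreover have "1 - (cmod z)\<^sup>2 > 0" using z by (simp add: abs_square_less_1)
  ultimately show ?thesis by (simp add: field_simps)
qed

lemma Bloch_norm_at_0:
  assumes f: "f \<in> Bloch"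
  shows "cmod (f 0) \<le> Bloch_norm f"
proof -
  \<comment> \<open>The supremum dominates its value at the origin and is therefore
    nonnegative.\<close>
  have "(1 - (cmod 0)\<^sup>2) * cmod (deriv f 0)
      \<le> (SUP z\<in>unit_disc. (1 - (cmod z)\<^sup>2) * cmod (deriv f z))"
    using f by (intro cSUP_upper) (auto simp: Bloch_def)
  then have "0 \<le> (SUP z\<in>unit_disc. (1 - (cmod z)\<^sup>2) * cmod (deriv f z))"
    by (rule order_trans[rotated]) simp
  then show ?thesis by (simp add: Bloch_norm_def)
qed

lemma Bloch_norm_nonneg: "f \<in> Bloch \<Longrightarrow> 0 \<le> Bloch_norm f"
  using Bloch_norm_at_0 norm_ge_zero order_trans by blast

text \<open>Mean value inequality on the closed disc of radius \<open>cmod w\<close>, where the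
  bound for the derivative is largest on the boundary. It is applied at \<open>w = \<phi> 0\<close>
  to control the value of a composition at the origin.\<close>

lemma Bloch_growth:
  fixes w :: complex
  assumes f: "f \<in> Bloch" and w: "w \<in> unit_disc"
  shows "cmod (f w) \<le> (1 + 1 / (1 - (cmod w)\<^sup>2)) * Bloch_norm f"
proof -
  note nonneg = Bloch_norm_nonneg[OF f]
  have pos: "1 - (cmod w)\<^sup>2 > 0" using w by (simp add: abs_square_less_1)
  have sub: "cball 0 (cmod w) \<subseteq> unit_disc" using w by auto
  have "cmod (f w - f 0) \<le> Bloch_norm f / (1 - (cmod w)\<^sup>2) * cmod (w - 0)"
  proof (rule field_differentiable_bound[of "cball 0 (cmod w)" f "deriv f"])
    fix z :: complex assume z: "z \<in> cball 0 (cmod w)"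
    show "(f has_field_derivative deriv f z) (at z within cball 0 (cmod w))"
      using f z sub unfolding Bloch_def Hol_disc_def
      by (auto intro!: holomorphic_derivI[of f unit_disc])
    have "cmod (deriv f z) \<le> Bloch_norm f / (1 - (cmod z)\<^sup>2)"
      using Bloch_deriv_le[OF f] z sub by auto
    also have "\<dots> \<le> Bloch_norm f / (1 - (cmod w)\<^sup>2)"
    proof -
      have "1 - (cmod w)\<^sup>2 \<le> 1 - (cmod z)\<^sup>2" using z by (intro diff_left_mono power_mono) auto
      then show ?thesis using pos nonneg by (intro divide_left_mono mult_pos_pos) linarith+
    qed
    finally show "cmod (deriv f z) \<le> Bloch_norm f / (1 - (cmod w)\<^sup>2)" .
  qed auto
  also have "\<dots> \<le> Bloch_norm f / (1 - (cmod w)\<^sup>2)"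
    using w pos nonneg by (simp add: divide_right_mono mult_left_le)
  finally have "cmod (f w - f 0) \<le> Bloch_norm f / (1 - (cmod w)\<^sup>2)" .
  then have "cmod (f w) \<le> Bloch_norm f + Bloch_norm f / (1 - (cmod w)\<^sup>2)"
    using norm_triangle_ineq2[of "f w" "f 0"] Bloch_norm_at_0[OF f] by simp
  then show ?thesis by (simp add: algebra_simps)
qed

lemma hyperbolic_deriv_nonneg:
  assumes "self_map_disc \<phi>" "z \<in> unit_disc"
  shows "0 \<le> hyperbolic_deriv \<phi> z"
proof -
  have "\<phi> z \<in> unit_disc" by (rule self_map_discD[OF assms])
  then have "(cmod (\<phi> z))\<^sup>2 \<le> 1" by (simp add: abs_square_le_1)
  then show ?thesis by (simp add: hyperbolic_deriv_def)
qed

section \<open>Integrability of the hyperbolic derivative and boundedness\<close>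

lemma space_borel_measure_disc:
  assumes "borel_measure_disc \<mu>"
  shows "space \<mu> = unit_disc"
  using sets_eq_imp_space_eq[OF assms[unfolded borel_measure_disc_def]]
  by (simp add: space_restrict_space)

lemma deriv_powr_measurable:
  assumes \<mu>: "borel_measure_disc \<mu>" and f: "f \<in> Hol_disc"
  shows "(\<lambda>z. ennreal (cmod (deriv f z) powr p)) \<in> borel_measurable \<mu>"
proof -
  have "deriv f holomorphic_on unit_disc"
    using f by (auto simp: Hol_disc_def intro: holomorphic_deriv)
  then have "deriv f \<in> borel_measurable (restrict_space borel unit_disc)"
    by (intro borel_measurable_continuous_on_restrict holomorphic_on_imp_continuous_on)
  then have "deriv f \<in> borel_measurable \<mu>"
    using measurable_cong_sets[of \<mu> "restrict_space borel unit_disc" borel borel] \<mu>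
    by (auto simp: borel_measure_disc_def)
  then show ?thesis by measurable
qed

text \<open>At each \<open>z\<close> some member \<open>f\<close> of the finite family has nearly
  maximal derivative at \<open>\<phi> z\<close>, so by the chain rule
  \<open>hyperbolic_deriv \<phi> z\<close> is at most 16 times the modulus of the derivative of
  \<open>comp_op \<phi> f\<close> at \<open>z\<close>. Each of the finitely many compositions has
  finite integral by (a).\<close>

lemma hyperbolic_deriv_integrable_if_maps:
  assumes p: "0 \<le> p" and \<mu>: "borel_measure_disc \<mu>" and \<phi>: "self_map_disc \<phi>"
    and maps: "\<forall>f\<in>Bloch. comp_op \<phi> f \<in> D_space p \<mu>"
  shows "(\<integral>\<^sup>+ z. ennreal (\<bar>hyperbolic_deriv \<phi> z\<bar> powr p) \<partial>\<mu>) < \<infinity>"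
proof -
  obtain F where F: "finite F" "F \<subseteq> Bloch" and
    large: "\<And>z. z \<in> unit_disc \<Longrightarrow> \<exists>f\<in>F. 1 \<le> 16 * (1 - (cmod z)\<^sup>2) * cmod (deriv f z)"
    using finite_Bloch_family_maximal_derivative by blast
  have Hol: "f \<in> Hol_disc" if "f \<in> F" for f using that F by (auto simp: Bloch_def)
  have "(\<integral>\<^sup>+ z. ennreal (\<bar>hyperbolic_deriv \<phi> z\<bar> powr p) \<partial>\<mu>)
      \<le> (\<integral>\<^sup>+ z. ennreal (16 powr p) * (\<Sum>f\<in>F. ennreal (cmod (deriv (comp_op \<phi> f) z) powr p)) \<partial>\<mu>)"
  proof (rule nn_integral_mono)
    fix z assume "z \<in> space \<mu>"
    then have z: "z \<in> unit_disc" using space_borel_measure_disc[OF \<mu>] by simp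
    have \<phi>z: "\<phi> z \<in> unit_disc" by (rule self_map_discD[OF \<phi> z])
    then obtain f where f: "f \<in> F"
      and le: "1 \<le> 16 * (1 - (cmod (\<phi> z))\<^sup>2) * cmod (deriv f (\<phi> z))"
      using large[OF \<phi>z] by blast
    have pos: "1 - (cmod (\<phi> z))\<^sup>2 > 0" using \<phi>z by (simp add: abs_square_less_1)
    have "cmod (deriv \<phi> z) \<le> 16 * (1 - (cmod (\<phi> z))\<^sup>2) * cmod (deriv f (\<phi> z)) * cmod (deriv \<phi> z)"
      using mult_right_mono[OF le, of "cmod (deriv \<phi> z)"] by simp
    then have "hyperbolic_deriv \<phi> z \<le> 16 * cmod (deriv (comp_op \<phi> f) z)"
      using pos by (simp add: hyperbolic_deriv_def deriv_comp_op[OF \<phi> Hol[OF f] z]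
          norm_mult field_simps)
    then have "\<bar>hyperbolic_deriv \<phi> z\<bar> powr p \<le> (16 * cmod (deriv (comp_op \<phi> f) z)) powr p"
      using p hyperbolic_deriv_nonneg[OF \<phi> z] by (intro powr_mono2) auto
    also have "\<dots> = 16 powr p * cmod (deriv (comp_op \<phi> f) z) powr p"
      by (simp add: powr_mult)
    finally have "ennreal (\<bar>hyperbolic_deriv \<phi> z\<bar> powr p)
        \<le> ennreal (16 powr p) * ennreal (cmod (deriv (comp_op \<phi> f) z) powr p)"
      by (simp add: ennreal_leI flip: ennreal_mult)
    \<comment> \<open>The chosen \<open>f\<close> depends on \<open>z\<close>; summing over all of
      \<open>F\<close> removes this dependence and leaves a measurable majorant.\<close>
    also have "\<dots> \<le> ennreal (16 powr p) * (\<Sum>f\<in>F. ennreal (cmod (deriv (comp_op \<phi> f) z) powr p))"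
      using F f by (intro mult_left_mono member_le_sum) auto
    finally show "ennreal (\<bar>hyperbolic_deriv \<phi> z\<bar> powr p)
        \<le> ennreal (16 powr p) * (\<Sum>f\<in>F. ennreal (cmod (deriv (comp_op \<phi> f) z) powr p))" .
  qed
  also have "\<dots> = ennreal (16 powr p) *
      (\<Sum>f\<in>F. \<integral>\<^sup>+ z. ennreal (cmod (deriv (comp_op \<phi> f) z) powr p) \<partial>\<mu>)"
    using deriv_powr_measurable[OF \<mu> comp_op_in_Hol_disc[OF \<phi> Hol]]
    by (simp add: nn_integral_cmult nn_integral_sum del: sum_ennreal)
  also have "\<dots> < \<infinity>"
    using maps F by (auto simp: D_space_def ennreal_mult_less_top subset_iff)
  finally show ?thesis .
qed

text \<open>The chain rule bounds the derivative of \<open>comp_op \<phi> f\<close> by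
  \<open>Bloch_norm f * hyperbolic_deriv \<phi> z\<close>, whose \<open>p\<close>-th power
  integrates to \<open>Bloch_norm f powr p * J\<close>; the value at 0 is bounded by the growth
  estimate at \<open>\<phi> 0\<close>.\<close>

lemma bounded_if_hyperbolic_deriv_integrable:
  assumes p: "0 < p" and \<mu>: "borel_measure_disc \<mu>" and \<phi>: "self_map_disc \<phi>"
    and fin: "(\<integral>\<^sup>+ z. ennreal (\<bar>hyperbolic_deriv \<phi> z\<bar> powr p) \<partial>\<mu>) < \<infinity>"
  shows "bounded_operator Bloch Bloch_norm (D_space p \<mu>) (D_norm p \<mu>) (comp_op \<phi>)"
proof -
  define J where "J = enn2real (\<integral>\<^sup>+ z. ennreal (\<bar>hyperbolic_deriv \<phi> z\<bar> powr p) \<partial>\<mu>)"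
  have J: "(\<integral>\<^sup>+ z. ennreal (\<bar>hyperbolic_deriv \<phi> z\<bar> powr p) \<partial>\<mu>) = ennreal J" "0 \<le> J"
    using fin by (auto simp: J_def)
  define A where "A = 1 + 1 / (1 - (cmod (\<phi> 0))\<^sup>2)"
  have \<phi>0: "\<phi> 0 \<in> unit_disc" using self_map_discD[OF \<phi>, of 0] by simp
  then have "1 - (cmod (\<phi> 0))\<^sup>2 > 0" by (simp add: abs_square_less_1)
  then have A: "0 \<le> A" by (simp add: A_def)
  have I: "(\<integral>\<^sup>+ z. ennreal (cmod (deriv (comp_op \<phi> f) z) powr p) \<partial>\<mu>)
      \<le> ennreal (Bloch_norm f powr p * J)" if f: "f \<in> Bloch" for f
  proof -
    have Hol: "f \<in> Hol_disc" using f by (simp add: Bloch_def)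
    \<comment> \<open>The absolute values make both factors visibly nonnegative, so that
      \<open>powr\<close> distributes over the product.\<close>
    have "(\<integral>\<^sup>+ z. ennreal (cmod (deriv (comp_op \<phi> f) z) powr p) \<partial>\<mu>)
        \<le> (\<integral>\<^sup>+ z. ennreal (\<bar>Bloch_norm f\<bar> powr p) * ennreal (\<bar>hyperbolic_deriv \<phi> z\<bar> powr p) \<partial>\<mu>)"
    proof (rule nn_integral_mono)
      fix z assume "z \<in> space \<mu>"
      then have z: "z \<in> unit_disc" using space_borel_measure_disc[OF \<mu>] by simp
      have \<phi>z: "\<phi> z \<in> unit_disc" by (rule self_map_discD[OF \<phi> z])
      have "cmod (deriv (comp_op \<phi> f) z) \<le> Bloch_norm f * hyperbolic_deriv \<phi> z"
        using mult_right_mono[OF Bloch_deriv_le[OF f \<phi>z], of "cmod (deriv \<phi> z)"]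
        by (simp add: deriv_comp_op[OF \<phi> Hol z] norm_mult hyperbolic_deriv_def)
      then have "cmod (deriv (comp_op \<phi> f) z) powr p \<le> \<bar>Bloch_norm f * hyperbolic_deriv \<phi> z\<bar> powr p"
        using p by (intro powr_mono2) auto
      also have "\<dots> = \<bar>Bloch_norm f\<bar> powr p * \<bar>hyperbolic_deriv \<phi> z\<bar> powr p"
        by (simp add: abs_mult powr_mult)
      finally show "ennreal (cmod (deriv (comp_op \<phi> f) z) powr p)
          \<le> ennreal (\<bar>Bloch_norm f\<bar> powr p) * ennreal (\<bar>hyperbolic_deriv \<phi> z\<bar> powr p)"
        by (simp add: ennreal_leI flip: ennreal_mult)
    qed
    also have "\<dots> = ennreal (\<bar>Bloch_norm f\<bar> powr p) * ennreal J"
    proof -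
      have "deriv \<phi> holomorphic_on unit_disc" and h: "\<phi> holomorphic_on unit_disc"
        using \<phi> by (auto simp: self_map_disc_def intro: holomorphic_deriv)
      moreover have "1 - (cmod (\<phi> z))\<^sup>2 \<noteq> 0" if "z \<in> unit_disc" for z
      proof -
        have "\<phi> z \<in> unit_disc" by (rule self_map_discD[OF \<phi> that])
        then have "1 - (cmod (\<phi> z))\<^sup>2 > 0" by (simp add: abs_square_less_1)
        then show ?thesis by simp
      qed
      ultimately have "continuous_on unit_disc (hyperbolic_deriv \<phi>)"
        unfolding hyperbolic_deriv_def
        by (intro continuous_intros holomorphic_on_imp_continuous_on) auto
      then have "hyperbolic_deriv \<phi> \<in> borel_measurable (restrict_space borel unit_disc)"
        by (rule borel_measurable_continuous_on_restrict)
      then have "hyperbolic_deriv \<phi> \<in> borel_measurable \<mu>"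
        using measurable_cong_sets[of \<mu> "restrict_space borel unit_disc" borel borel] \<mu>
        by (auto simp: borel_measure_disc_def)
      then have "(\<lambda>z. ennreal (\<bar>hyperbolic_deriv \<phi> z\<bar> powr p)) \<in> borel_measurable \<mu>"
        by measurable
      then show ?thesis by (simp add: nn_integral_cmult J)
    qed
    also have "\<dots> = ennreal (Bloch_norm f powr p * J)"
      using J Bloch_norm_nonneg[OF f] by (simp flip: ennreal_mult)
    finally show ?thesis .
  qed
  have maps: "comp_op \<phi> f \<in> D_space p \<mu>" if f: "f \<in> Bloch" for f
    using comp_op_in_Hol_disc[OF \<phi>, of f] f le_less_trans[OF I[OF f]]
    by (auto simp: D_space_def Bloch_def)
  have bound: "D_norm p \<mu> (comp_op \<phi> f) \<le> (A powr p + J) powr (1 / p) * Bloch_norm f"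
    if f: "f \<in> Bloch" for f
  proof -
    have "cmod (comp_op \<phi> f 0) \<le> A * Bloch_norm f"
      using Bloch_growth[OF f \<phi>0] by (simp add: comp_op_def A_def)
    then have "cmod (comp_op \<phi> f 0) powr p \<le> (A * Bloch_norm f) powr p"
      using p by (intro powr_mono2) auto
    also have "\<dots> = A powr p * Bloch_norm f powr p"
      using A Bloch_norm_nonneg[OF f] by (simp add: powr_mult)
    finally have 1: "cmod (comp_op \<phi> f 0) powr p \<le> A powr p * Bloch_norm f powr p" .
    \<comment> \<open>The integral is finite by \<open>I\<close>, so \<open>enn2real\<close> returns
      its true value and not the default 0.\<close>
    have 2: "enn2real (\<integral>\<^sup>+ z. ennreal (cmod (deriv (comp_op \<phi> f) z) powr p) \<partial>\<mu>)
        \<le> Bloch_norm f powr p * J"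
      using J by (intro enn2real_leI I[OF f]) auto
    have "D_norm p \<mu> (comp_op \<phi> f) \<le> ((A powr p + J) * Bloch_norm f powr p) powr (1 / p)"
      unfolding D_norm_def using 1 2 p by (intro powr_mono2) (auto simp: algebra_simps)
    also have "\<dots> = (A powr p + J) powr (1 / p) * Bloch_norm f"
      using J p Bloch_norm_nonneg[OF f] by (simp add: powr_mult powr_powr)
    finally show ?thesis .
  qed
  show ?thesis
    unfolding bounded_operator_def using maps bound
    by (auto simp: comp_op_def fun_eq_iff)
qed

theorem proposition1:
  fixes p :: real and \<mu> :: "complex measure" and \<phi> :: "complex \<Rightarrow> complex"
  assumes "1 \<le> p"
    and "borel_measure_disc \<mu>"
    and "banach_function_space (D_space p \<mu>) (D_norm p \<mu>)"
    and "evaluations_locally_bounded (D_space p \<mu>) (D_norm p \<mu>)"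
    and "self_map_disc \<phi>"
  shows "((\<forall>f\<in>Bloch. comp_op \<phi> f \<in> D_space p \<mu>) \<longleftrightarrow>
            bounded_operator Bloch Bloch_norm (D_space p \<mu>) (D_norm p \<mu>) (comp_op \<phi>))
       \<and> (bounded_operator Bloch Bloch_norm (D_space p \<mu>) (D_norm p \<mu>) (comp_op \<phi>) \<longleftrightarrow>
            (\<integral>\<^sup>+ z. ennreal (\<bar>hyperbolic_deriv \<phi> z\<bar> powr p) \<partial>\<mu>) < \<infinity>)"
proof -
  have "\<forall>f\<in>Bloch. comp_op \<phi> f \<in> D_space p \<mu>"
    if "bounded_operator Bloch Bloch_norm (D_space p \<mu>) (D_norm p \<mu>) (comp_op \<phi>)"
    using that by (auto simp: bounded_operator_def)
  moreover have "0 < p" using assms(1) by simp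
  \<comment> \<open>The cycle is (b) to (a), (a) to (c), (c) to (b).\<close>
  ultimately show ?thesis
    using hyperbolic_deriv_integrable_if_maps[of p \<mu> \<phi>]
      bounded_if_hyperbolic_deriv_integrable[of p \<mu> \<phi>] assms(2,5) less_imp_le[of 0 p]
    by blast
qed

end
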